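(* Let $\mathcal{E}_1=(E_1;+_1,q_1,d_1,0_1,1_1)$ and $\mathcal{E}_2=(E_2;+_2,q_2,d_2,0_2,1_2)$ be q-representable q-Jauch-Piron q-effect algebras, and let $f:E_1\to E_2$ and $g:E_2\to E_1$ be mappings such that $(f,g)$ is a Galois q-connection. Let $T$ be the set of all Jauch-Piron q-states on $\mathcal{E}_2$ and $S$ the set of all Jauch-Piron q-states on $\mathcal{E}_1$. Define $R_g\subseteq S\times T$ by $$sR_gt \iff s(g(x))\leq t(x)\ \text{for all } x\in E_2 .$$ Then $f$ and $g$ are representable via the canonical Galois connection $(P^*,G^* )$ between $[0,1]^S$ and $[0,1]^T$ induced by the frame $(S,T,R_g)$ and the standard q-effect algebra, $P^*:[0,1]^S\to[0,1]^T$, $G^*:[0,1]^T\to[0,1]^S$; that is, $$i_{E_2}^T\circ f=P^*\circ i_{E_1}^S\quad\text{and}\quad i_{E_1}^S\circ g=G^*\circ i_{E_2}^T,$$ where $i_{E_2}^T:E_2\to[0,1]^T$, $x\mapsto (t(x))_{t\in T}$, and $i_{E_1}^S:E_1\to[0,1]^S$, $y\mapsto(s(y))_{s\in S}$.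
   Context: An effect algebra is a structure $(E;+,0,1)$ with distinguished elements $0\neq 1$ of $E$ and a partial binary operation $+$ such that for $x,y,z\in E$: (E1) if $x+y$ is defined then $y+x$ is defined and $x+y=y+x$; (E2) if $y+z$ and $x+(y+z)$ are defined then $x+y$ and $(x+y)+z$ are defined and $(x+y)+z=x+(y+z)$; (E3) for each $x$ there is a unique $x'\in E$ with $x+x'=1$; (E4) if $x+1$ is defined then $x=0$. The induced order is $x\leq y$ iff $x+z=y$ for some $z\in E$; it is a partial order with bottom $0$ and top $1$, and $x+y$ is defined iff $x\leq y'$. The dual partial operation: $x\cdot y$ is defined iff $x'\leq y$, and then $x\cdot y=(x'+y')'$. A q-effect algebra $(E;+,q,d,0,1)$ is an effect algebra with maps $q,d:E\to E$ such that for all $x,y,z\in E$: (Q1) $d(x')=q(x)'$; (Q2) $d(0)=0=q(0)$; (Q3) $d$ is order-preserving; (Q4) $x'\leq x$ implies $x\cdot x=d(x)$; (Q5) $z\leq x$, $z\leq y$ and $y'\leq x$ imply $d(z)\leq x\cdot y$. A pair $(f,g)$, $f:E_1\to E_2$, $g:E_2\to E_1$, is a Galois connection if $f(a)\leq b\iff a\leq g(b)$ for all $a\in E_1,b\in E_2$. It is a Galois q-connection if moreover $f(q_1(x))=q_2(f(x))$, $f(d_1(x))=d_2(f(x))$, $g(q_2(y))=q_1(g(y))$, $g(d_2(y))=d_1(g(y))$ for all $x\in E_1$, $y\in E_2$. On $[0,1]$ put $a\oplus b=\min(1,a+b)$ and $a\odot b=\max(0,a+b-1)$. The standard q-effect algebra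 is $[0,1]$ with $a+b$ defined iff the usual sum is $\leq 1$, $q(a)=a\oplus a$, $d(a)=a\odot a$; powers of it carry componentwise operations. A q-state on $\mathcal{E}$ is a map $s:E\to[0,1]$ with $s(0)=0$, $s(1)=1$, $s(x+y)=s(x)+s(y)$ whenever $x+y$ is defined, $s(q(x))=s(x)\oplus s(x)$ and $s(d(x))=s(x)\odot s(x)$ for all $x$. A q-state $s$ is Jauch-Piron if $s(x)=1=s(y)$ implies $s(z)=1$ for some $z\in E$ with $z\leq x$ and $z\leq y$. A set $S$ of q-states on $\mathcal{E}$ is order reflecting if for all $a,b\in E$: ($s(a)\leq s(b)$ for all $s\in S$) implies $a\leq b$. $\mathcal{E}$ is q-representable if it has an order reflecting set of q-states. $\mathcal{E}$ is a q-Jauch-Piron q-effect algebra if every q-state on $\mathcal{E}$ is Jauch-Piron. A frame is a triple $(S,T,R)$ with $S,T$ non-empty sets and $R\subseteq S\times T$. The canonical Galois connection $(P^*,G^* )$ induced by $(S,T,R)$ and the standard q-effect algebra is given by $G^*:[0,1]^T\to[0,1]^S$, $G^*(p)(s)=\bigwedge\{p(t)\mid t\in T, sRt\}$, and $P^*:[0,1]^S\to[0,1]^T$, $P^*(p)(t)=\bigvee\{p(s)\mid s\in S, sRt\}$ (with $\bigwedge\emptyset=1$, $\bigvee\emptyset=0$). *)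

theory Defs
  imports "HOL-Library.FuncSet" "HOL-Algebra.Congruence" Complex_Main
begin

section \<open>Effect algebras and q-effect algebras\<close>

text \<open>A partial operation is a function into an option type; \<open>None\<close> means undefined.\<close>

record 'a effect_algebra = "'a partial_object" +
  padd :: "'a \<Rightarrow> 'a \<Rightarrow> 'a option"
  bottom :: 'a
  unit_elt :: 'a

definition ea_le :: "('a, 'm) effect_algebra_scheme \<Rightarrow> 'a \<Rightarrow> 'a \<Rightarrow> bool" where
  "ea_le E x y \<longleftrightarrow> (\<exists>z\<in>carrier E. padd E x z = Some y)"

definition ea_compl :: "('a, 'm) effect_algebra_scheme \<Rightarrow> 'a \<Rightarrow> 'a" where
  "ea_compl E x = (THE y. y \<in> carrier E \<and> padd E x y = Some (unit_elt E))"

definition pmult :: "('a, 'm) effect_algebra_scheme \<Rightarrow> 'a \<Rightarrow> 'a \<Rightarrow> 'a option" where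
  "pmult E x y =
     (if ea_le E (ea_compl E x) y
      then map_option (ea_compl E) (padd E (ea_compl E x) (ea_compl E y))
      else None)"

locale effect_algebra =
  fixes E :: "('a, 'm) effect_algebra_scheme" (structure)
  assumes bottom_closed: "bottom E \<in> carrier E"
    and unit_closed: "unit_elt E \<in> carrier E"
    and bottom_neq_unit: "bottom E \<noteq> unit_elt E"
    and padd_closed:
      "\<lbrakk>x \<in> carrier E; y \<in> carrier E; padd E x y = Some u\<rbrakk> \<Longrightarrow> u \<in> carrier E"
    and E1:
      "\<lbrakk>x \<in> carrier E; y \<in> carrier E; padd E x y = Some u\<rbrakk> \<Longrightarrow> padd E y x = Some u"
    and E2:
      "\<lbrakk>x \<in> carrier E; y \<in> carrier E; z \<in> carrier E;
        padd E y z = Some u; padd E x u = Some v\<rbrakk>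
       \<Longrightarrow> \<exists>w. padd E x y = Some w \<and> padd E w z = Some v"
    and E3: "x \<in> carrier E \<Longrightarrow> \<exists>!y. y \<in> carrier E \<and> padd E x y = Some (unit_elt E)"
    and E4: "\<lbrakk>x \<in> carrier E; padd E x (unit_elt E) \<noteq> None\<rbrakk> \<Longrightarrow> x = bottom E"

record 'a q_effect_algebra = "'a effect_algebra" +
  q_op :: "'a \<Rightarrow> 'a"
  d_op :: "'a \<Rightarrow> 'a"

locale q_effect_algebra = effect_algebra E
  for E :: "('a, 'm) q_effect_algebra_scheme" (structure) +
  assumes q_closed: "x \<in> carrier E \<Longrightarrow> q_op E x \<in> carrier E"
    and d_closed: "x \<in> carrier E \<Longrightarrow> d_op E x \<in> carrier E"
    and Q1: "x \<in> carrier E \<Longrightarrow> d_op E (ea_compl E x) = ea_compl E (q_op E x)"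
    and Q2: "d_op E (bottom E) = bottom E" "q_op E (bottom E) = bottom E"
    and Q3: "\<lbrakk>x \<in> carrier E; y \<in> carrier E; ea_le E x y\<rbrakk> \<Longrightarrow> ea_le E (d_op E x) (d_op E y)"
    and Q4: "\<lbrakk>x \<in> carrier E; ea_le E (ea_compl E x) x\<rbrakk> \<Longrightarrow> pmult E x x = Some (d_op E x)"
    and Q5:
      "\<lbrakk>x \<in> carrier E; y \<in> carrier E; z \<in> carrier E;
        ea_le E z x; ea_le E z y; ea_le E (ea_compl E y) x\<rbrakk>
       \<Longrightarrow> \<exists>u. pmult E x y = Some u \<and> ea_le E (d_op E z) u"

section \<open>Galois connections\<close>

definition galois_connection ::
  "('a, 'm) effect_algebra_scheme \<Rightarrow> ('b, 'n) effect_algebra_scheme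
     \<Rightarrow> ('a \<Rightarrow> 'b) \<Rightarrow> ('b \<Rightarrow> 'a) \<Rightarrow> bool" where
  "galois_connection E1 E2 f g \<longleftrightarrow>
     f \<in> carrier E1 \<rightarrow> carrier E2 \<and> g \<in> carrier E2 \<rightarrow> carrier E1 \<and>
     (\<forall>a\<in>carrier E1. \<forall>b\<in>carrier E2. ea_le E2 (f a) b \<longleftrightarrow> ea_le E1 a (g b))"

definition galois_q_connection ::
  "('a, 'm) q_effect_algebra_scheme \<Rightarrow> ('b, 'n) q_effect_algebra_scheme
     \<Rightarrow> ('a \<Rightarrow> 'b) \<Rightarrow> ('b \<Rightarrow> 'a) \<Rightarrow> bool" where
  "galois_q_connection E1 E2 f g \<longleftrightarrow>
     galois_connection E1 E2 f g \<and>
     (\<forall>x\<in>carrier E1. f (q_op E1 x) = q_op E2 (f x) \<and> f (d_op E1 x) = d_op E2 (f x)) \<and>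
     (\<forall>y\<in>carrier E2. g (q_op E2 y) = q_op E1 (g y) \<and> g (d_op E2 y) = d_op E1 (g y))"

section \<open>The standard q-effect algebra and its powers\<close>

definition luk_oplus :: "real \<Rightarrow> real \<Rightarrow> real" where
  "luk_oplus a b = min 1 (a + b)"

definition luk_odot :: "real \<Rightarrow> real \<Rightarrow> real" where
  "luk_odot a b = max 0 (a + b - 1)"

definition standard_qea :: "real q_effect_algebra" where
  "standard_qea =
     \<lparr>carrier = {0..1},
      padd = (\<lambda>a b. if a + b \<le> 1 then Some (a + b) else None),
      bottom = 0, unit_elt = 1,
      q_op = (\<lambda>a. luk_oplus a a), d_op = (\<lambda>a. luk_odot a a)\<rparr>"

definition power_qea :: "'a q_effect_algebra \<Rightarrow> 'i set \<Rightarrow> ('i \<Rightarrow> 'a) q_effect_algebra" where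
  "power_qea E I =
     \<lparr>carrier = I \<rightarrow>\<^sub>E carrier E,
      padd = (\<lambda>p r. if \<forall>i\<in>I. padd E (p i) (r i) \<noteq> None
                    then Some (\<lambda>i\<in>I. the (padd E (p i) (r i))) else None),
      bottom = (\<lambda>i\<in>I. bottom E), unit_elt = (\<lambda>i\<in>I. unit_elt E),
      q_op = (\<lambda>p. \<lambda>i\<in>I. q_op E (p i)), d_op = (\<lambda>p. \<lambda>i\<in>I. d_op E (p i))\<rparr>"

section \<open>q-states\<close>

text \<open>A map out of the carrier is an extensional function, so that equality of q-states
  is agreement on the carrier.\<close>

definition q_state :: "('a, 'm) q_effect_algebra_scheme \<Rightarrow> ('a \<Rightarrow> real) \<Rightarrow> bool" where
  "q_state E s \<longleftrightarrow>
     s \<in> carrier E \<rightarrow>\<^sub>E {0..1} \<and> s (bottom E) = 0 \<and> s (unit_elt E) = 1 \<and>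
     (\<forall>x\<in>carrier E. \<forall>y\<in>carrier E. \<forall>u. padd E x y = Some u \<longrightarrow> s u = s x + s y) \<and>
     (\<forall>x\<in>carrier E. s (q_op E x) = luk_oplus (s x) (s x)) \<and>
     (\<forall>x\<in>carrier E. s (d_op E x) = luk_odot (s x) (s x))"

definition jauch_piron :: "('a, 'm) q_effect_algebra_scheme \<Rightarrow> ('a \<Rightarrow> real) \<Rightarrow> bool" where
  "jauch_piron E s \<longleftrightarrow>
     (\<forall>x\<in>carrier E. \<forall>y\<in>carrier E. s x = 1 \<and> s y = 1 \<longrightarrow>
        (\<exists>z\<in>carrier E. ea_le E z x \<and> ea_le E z y \<and> s z = 1))"

definition order_reflecting ::
  "('a, 'm) q_effect_algebra_scheme \<Rightarrow> ('a \<Rightarrow> real) set \<Rightarrow> bool" where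
  "order_reflecting E S \<longleftrightarrow>
     (\<forall>a\<in>carrier E. \<forall>b\<in>carrier E. (\<forall>s\<in>S. s a \<le> s b) \<longrightarrow> ea_le E a b)"

definition q_representable :: "('a, 'm) q_effect_algebra_scheme \<Rightarrow> bool" where
  "q_representable E \<longleftrightarrow> (\<exists>S. (\<forall>s\<in>S. q_state E s) \<and> order_reflecting E S)"

definition q_jauch_piron :: "('a, 'm) q_effect_algebra_scheme \<Rightarrow> bool" where
  "q_jauch_piron E \<longleftrightarrow> (\<forall>s. q_state E s \<longrightarrow> jauch_piron E s)"

definition eval_map :: "('a, 'm) q_effect_algebra_scheme \<Rightarrow> ('a \<Rightarrow> real) set
    \<Rightarrow> 'a \<Rightarrow> ('a \<Rightarrow> real) \<Rightarrow> real" where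
  "eval_map E S = (\<lambda>x\<in>carrier E. \<lambda>s\<in>S. s x)"

section \<open>Frames and the canonical Galois connection\<close>

definition frame :: "'s set \<Rightarrow> 't set \<Rightarrow> ('s \<times> 't) set \<Rightarrow> bool" where
  "frame S T R \<longleftrightarrow> S \<noteq> {} \<and> T \<noteq> {} \<and> R \<subseteq> S \<times> T"

text \<open>Infima and suprema are those of the complete lattice \<open>[0,1]\<close>; on the reals,
  \<open>Inf {}\<close> and \<open>Sup {}\<close> are unspecified.\<close>

definition unit_Inf :: "real set \<Rightarrow> real" where
  "unit_Inf A = (if A = {} then 1 else Inf A)"

definition unit_Sup :: "real set \<Rightarrow> real" where
  "unit_Sup A = (if A = {} then 0 else Sup A)"

definition canonical_G :: "'s set \<Rightarrow> 't set \<Rightarrow> ('s \<times> 't) set \<Rightarrow> ('t \<Rightarrow> real) \<Rightarrow> 's \<Rightarrow> real" where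
  "canonical_G S T R =
     (\<lambda>p \<in> carrier (power_qea standard_qea T). \<lambda>s\<in>S. unit_Inf {p t | t. t \<in> T \<and> (s, t) \<in> R})"

definition canonical_P :: "'s set \<Rightarrow> 't set \<Rightarrow> ('s \<times> 't) set \<Rightarrow> ('s \<Rightarrow> real) \<Rightarrow> 't \<Rightarrow> real" where
  "canonical_P S T R =
     (\<lambda>p \<in> carrier (power_qea standard_qea S). \<lambda>t\<in>T. unit_Sup {p s | s. s \<in> S \<and> (s, t) \<in> R})"

section \<open>The standard q-effect algebra, its powers and frames: basic facts\<close>

lemma (in effect_algebra) ea_compl_eq:
  assumes "x \<in> carrier E" "y \<in> carrier E" "padd E x y = Some (unit_elt E)"
  shows "ea_compl E x = y"
  unfolding ea_compl_def using E3[OF assms(1)] assms by (intro the1_equality) auto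

lemma (in effect_algebra) ea_compl_props:
  assumes "x \<in> carrier E"
  shows "ea_compl E x \<in> carrier E" "padd E x (ea_compl E x) = Some (unit_elt E)"
  using theI'[OF E3[OF assms]] unfolding ea_compl_def by auto

lemma standard_sel:
  "carrier standard_qea = {0..1}"
  "padd standard_qea a b = (if a + b \<le> 1 then Some (a + b) else None)"
  "bottom standard_qea = 0" "unit_elt standard_qea = 1"
  "q_op standard_qea a = luk_oplus a a" "d_op standard_qea a = luk_odot a a"
  by (simp_all add: standard_qea_def)

lemma q_effect_algebra_standard: "q_effect_algebra standard_qea"
proof -
  have ea: "effect_algebra standard_qea"
  proof (unfold_locales, goal_cases)
    case (7 x)
    then show ?case
      by (intro ex1I[of _ "1 - x"]) (auto simp: standard_qea_def split: if_splits)
  qed (auto simp: standard_qea_def split: if_splits)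
  then interpret effect_algebra standard_qea .
  have compl: "ea_compl standard_qea x = 1 - x" if "0 \<le> x" "x \<le> 1" for x
    using that by (intro ea_compl_eq) (auto simp: standard_qea_def)
  have le: "ea_le standard_qea x y \<longleftrightarrow> x \<le> y" if "0 \<le> x" "y \<le> 1" for x y
    using that unfolding ea_le_def
    by (auto simp: standard_qea_def split: if_splits intro!: bexI[of _ "y - x"])
  show ?thesis
    by unfold_locales
      (auto simp: standard_sel compl le pmult_def luk_oplus_def luk_odot_def min_def max_def)
qed

context
  fixes E :: "'a q_effect_algebra" and I :: "'i set"
  assumes E: "q_effect_algebra E" and ne: "I \<noteq> {}"
begin

interpretation q_effect_algebra E by (fact E)

lemma power_sel:
  "carrier (power_qea E I) = I \<rightarrow>\<^sub>E carrier E"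
  "padd (power_qea E I) p r = (if \<forall>i\<in>I. padd E (p i) (r i) \<noteq> None
                    then Some (\<lambda>i\<in>I. the (padd E (p i) (r i))) else None)"
  "bottom (power_qea E I) = (\<lambda>i\<in>I. bottom E)"
  "unit_elt (power_qea E I) = (\<lambda>i\<in>I. unit_elt E)"
  "q_op (power_qea E I) p = (\<lambda>i\<in>I. q_op E (p i))"
  "d_op (power_qea E I) p = (\<lambda>i\<in>I. d_op E (p i))"
  by (simp_all add: power_qea_def)

lemma power_padd_iff:
  "padd (power_qea E I) p r = Some u \<longleftrightarrow>
     u \<in> extensional I \<and> (\<forall>i\<in>I. padd E (p i) (r i) = Some (u i))"
proof
  assume "padd (power_qea E I) p r = Some u"
  then show "u \<in> extensional I \<and> (\<forall>i\<in>I. padd E (p i) (r i) = Some (u i))"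
    by (auto simp: power_sel split: if_splits)
next
  assume *: "u \<in> extensional I \<and> (\<forall>i\<in>I. padd E (p i) (r i) = Some (u i))"
  then have "(\<lambda>i\<in>I. the (padd E (p i) (r i))) = u"
    by (intro extensionalityI[of _ I]) auto
  with * show "padd (power_qea E I) p r = Some u"
    by (auto simp: power_sel)
qed

lemma power_le_iff:
  assumes "r \<in> I \<rightarrow>\<^sub>E carrier E"
  shows "ea_le (power_qea E I) p r \<longleftrightarrow> (\<forall>i\<in>I. ea_le E (p i) (r i))"
proof
  assume "\<forall>i\<in>I. ea_le E (p i) (r i)"
  then obtain z where z: "\<forall>i\<in>I. z i \<in> carrier E \<and> padd E (p i) (z i) = Some (r i)"
    unfolding ea_le_def by metis
  with assms show "ea_le (power_qea E I) p r"
    unfolding ea_le_def power_padd_iff power_sel(1)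
    by (intro bexI[of _ "restrict z I"]) (auto simp: PiE_def)
qed (auto simp: ea_le_def power_padd_iff power_sel(1))

lemma effect_algebra_power: "effect_algebra (power_qea E I)"
proof (unfold_locales, goal_cases)
  case 3
  from ne obtain i where "i \<in> I" by blast
  then show ?case using bottom_neq_unit by (auto simp: power_sel fun_eq_iff)
next
  case (4 x y u)
  then show ?case unfolding power_padd_iff
    by (auto simp: power_sel PiE_def Pi_def intro: padd_closed)
next
  case (5 x y u)
  then show ?case unfolding power_padd_iff power_sel(1) by (blast intro: E1 PiE_mem)
next
  case (6 x y z u v)
  have "\<exists>w. padd E (x i) (y i) = Some w \<and> padd E w (z i) = Some (v i)" if "i \<in> I" for i
    using 6 that unfolding power_padd_iff by (intro E2[of _ _ _ "u i"]) (auto simp: power_sel)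
  then obtain w where w: "\<And>i. i \<in> I \<Longrightarrow> padd E (x i) (y i) = Some (w i) \<and> padd E (w i) (z i) = Some (v i)"
    by metis
  with 6 show ?case unfolding power_padd_iff
    by (intro exI[of _ "restrict w I"]) auto
next
  case (7 x)
  show ?case
  proof (rule ex1I[of _ "\<lambda>i\<in>I. ea_compl E (x i)"])
    show "(\<lambda>i\<in>I. ea_compl E (x i)) \<in> carrier (power_qea E I) \<and>
        padd (power_qea E I) x (\<lambda>i\<in>I. ea_compl E (x i)) = Some (unit_elt (power_qea E I))"
      using 7 unfolding power_padd_iff by (auto simp: power_sel ea_compl_props PiE_iff)
  next
    fix y assume "y \<in> carrier (power_qea E I) \<and> padd (power_qea E I) x y = Some (unit_elt (power_qea E I))"
    then show "y = (\<lambda>i\<in>I. ea_compl E (x i))"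
      using 7 unfolding power_padd_iff
      by (intro extensionalityI[of _ I]) (auto simp: power_sel PiE_def Pi_def ea_compl_eq)
  qed
next
  case (8 x)
  then obtain u where "padd (power_qea E I) x (unit_elt (power_qea E I)) = Some u" by auto
  then have "\<forall>i\<in>I. padd E (x i) (unit_elt E) \<noteq> None"
    unfolding power_padd_iff by (auto simp: power_sel)
  with 8(1) show ?case
    by (intro extensionalityI[of _ I]) (auto simp: power_sel PiE_def Pi_def intro!: E4)
qed (auto simp: power_sel bottom_closed unit_closed)

lemma power_compl:
  assumes "p \<in> I \<rightarrow>\<^sub>E carrier E"
  shows "ea_compl (power_qea E I) p = (\<lambda>i\<in>I. ea_compl E (p i))"
  using assms
  by (intro effect_algebra.ea_compl_eq[OF effect_algebra_power])
    (auto simp: power_padd_iff power_sel(1,4) ea_compl_props PiE_iff)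

lemma pmult_SomeD:
  assumes "pmult E x y = Some u"
  shows "ea_le E (ea_compl E x) y"
    "\<exists>v. padd E (ea_compl E x) (ea_compl E y) = Some v \<and> u = ea_compl E v"
  using assms by (auto simp: pmult_def split: if_splits)

lemma power_pmult:
  assumes p: "p \<in> I \<rightarrow>\<^sub>E carrier E" and r: "r \<in> I \<rightarrow>\<^sub>E carrier E" and u: "u \<in> extensional I"
    and *: "\<And>i. i \<in> I \<Longrightarrow> pmult E (p i) (r i) = Some (u i)"
  shows "pmult (power_qea E I) p r = Some u"
proof -
  note D = pmult_SomeD[OF *]
  from D(2) obtain v where v: "\<And>i. i \<in> I \<Longrightarrow>
      padd E (ea_compl E (p i)) (ea_compl E (r i)) = Some (v i) \<and> u i = ea_compl E (v i)"
    by metis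
  have vc: "restrict v I \<in> I \<rightarrow>\<^sub>E carrier E"
    using v p r by (auto simp: PiE_iff intro!: padd_closed[OF _ _ conjunct1[OF v]] ea_compl_props)
  have "padd (power_qea E I) (ea_compl (power_qea E I) p) (ea_compl (power_qea E I) r) = Some (restrict v I)"
    unfolding power_padd_iff power_compl[OF p] power_compl[OF r] using v by auto
  moreover have "ea_le (power_qea E I) (ea_compl (power_qea E I) p) r"
    unfolding power_le_iff[OF r] power_compl[OF p] using D(1) by auto
  moreover have "ea_compl (power_qea E I) (restrict v I) = u"
    unfolding power_compl[OF vc] using u v by (intro extensionalityI[of _ I]) auto
  ultimately show ?thesis by (simp add: pmult_def)
qed

lemma q_effect_algebra_power: "q_effect_algebra (power_qea E I)"
proof -
  interpret P: effect_algebra "power_qea E I" by (rule effect_algebra_power)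
  have qc: "q_op (power_qea E I) x \<in> I \<rightarrow>\<^sub>E carrier E" if "x \<in> I \<rightarrow>\<^sub>E carrier E" for x
    using that by (auto simp: power_sel PiE_iff q_closed)
  have dc: "d_op (power_qea E I) x \<in> I \<rightarrow>\<^sub>E carrier E" if "x \<in> I \<rightarrow>\<^sub>E carrier E" for x
    using that by (auto simp: power_sel PiE_iff d_closed)
  show ?thesis
  proof (unfold_locales, goal_cases)
    case (1 x) then show ?case using qc by (simp add: power_sel(1))
  next
    case (2 x) then show ?case using dc by (simp add: power_sel(1))
  next
    case (3 x)
    then have x: "x \<in> I \<rightarrow>\<^sub>E carrier E" by (simp add: power_sel)
    show ?case
      unfolding power_compl[OF x] power_compl[OF qc[OF x]] using x
      by (intro extensionalityI[of _ I]) (auto simp: power_sel Q1 PiE_iff)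
  next
    case 4 show ?case by (auto simp: power_sel Q2)
  next
    case 5 show ?case by (auto simp: power_sel Q2)
  next
    case (6 x y)
    then have x: "x \<in> I \<rightarrow>\<^sub>E carrier E" "y \<in> I \<rightarrow>\<^sub>E carrier E" by (simp_all add: power_sel)
    from 6(3) show ?case
      unfolding power_le_iff[OF x(2)] power_le_iff[OF dc[OF x(2)]]
      using x by (auto simp: power_sel PiE_iff intro!: Q3)
  next
    case (7 x)
    then have x: "x \<in> I \<rightarrow>\<^sub>E carrier E" by (simp add: power_sel)
    from 7(2) show ?case unfolding power_le_iff[OF x]
      using x by (intro power_pmult) (auto simp: power_sel(6) power_compl PiE_iff intro!: Q4)
  next
    case (8 x y z)
    then have xyz: "x \<in> I \<rightarrow>\<^sub>E carrier E" "y \<in> I \<rightarrow>\<^sub>E carrier E" "z \<in> I \<rightarrow>\<^sub>E carrier E"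
      by (simp_all add: power_sel)
    have "\<exists>u. pmult E (x i) (y i) = Some u \<and> ea_le E (d_op E (z i)) u" if i: "i \<in> I" for i
    proof (rule Q5)
      show "ea_le E (ea_compl E (y i)) (x i)"
        using 8(6) i unfolding power_le_iff[OF xyz(1)] power_compl[OF xyz(2)] by auto
    qed (use 8 i xyz in \<open>auto simp: power_le_iff\<close>)
    then obtain u where u: "\<And>i. i \<in> I \<Longrightarrow> pmult E (x i) (y i) = Some (u i) \<and> ea_le E (d_op E (z i)) (u i)"
      by metis
    have uc: "u i \<in> carrier E" if i: "i \<in> I" for i
    proof -
      from pmult_SomeD(2) u[OF i] obtain v where
        "padd E (ea_compl E (x i)) (ea_compl E (y i)) = Some v" "u i = ea_compl E v" by metis
      moreover have "ea_compl E (x i) \<in> carrier E" "ea_compl E (y i) \<in> carrier E"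
        using xyz(1,2) i by (simp_all add: PiE_iff ea_compl_props(1))
      ultimately show ?thesis
        using padd_closed[of "ea_compl E (x i)" "ea_compl E (y i)" v] ea_compl_props(1)[of v] by simp
    qed
    then have uc: "restrict u I \<in> I \<rightarrow>\<^sub>E carrier E" by auto
    have "pmult (power_qea E I) x y = Some (restrict u I)"
      using xyz u by (intro power_pmult) auto
    moreover have "ea_le (power_qea E I) (d_op (power_qea E I) z) (restrict u I)"
      unfolding power_le_iff[OF uc] using u by (auto simp: power_sel)
    ultimately show ?case by blast
  qed
qed

end

lemma galois_connection_canonical:
  assumes "frame S T R"
  shows "galois_connection (power_qea standard_qea S) (power_qea standard_qea T)
           (canonical_P S T R) (canonical_G S T R)"
proof -
  let ?S = "power_qea standard_qea S" and ?T = "power_qea standard_qea T"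
  have ne: "S \<noteq> {}" "T \<noteq> {}" using assms by (auto simp: frame_def)
  have car: "carrier ?S = S \<rightarrow>\<^sub>E {0..1}" "carrier ?T = T \<rightarrow>\<^sub>E {0..1}"
    by (auto simp: power_qea_def standard_qea_def)
  have cs: "carrier standard_qea = {0..1}" by (simp add: standard_qea_def)
  have le0: "ea_le standard_qea x y \<longleftrightarrow> x \<le> y" if "0 \<le> x" "y \<le> 1" for x y
    using that unfolding ea_le_def
    by (auto simp: standard_qea_def split: if_splits intro!: bexI[of _ "y - x"])
  have leS: "ea_le ?S p r \<longleftrightarrow> (\<forall>i\<in>S. p i \<le> r i)" if "p \<in> S \<rightarrow>\<^sub>E {0..1}" "r \<in> S \<rightarrow>\<^sub>E {0..1}" for p r
    using that by (subst power_le_iff[OF q_effect_algebra_standard ne(1)])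
      (auto simp: cs le0 PiE_iff)
  have leT: "ea_le ?T p r \<longleftrightarrow> (\<forall>i\<in>T. p i \<le> r i)" if "p \<in> T \<rightarrow>\<^sub>E {0..1}" "r \<in> T \<rightarrow>\<^sub>E {0..1}" for p r
    using that by (subst power_le_iff[OF q_effect_algebra_standard ne(2)])
      (auto simp: cs le0 PiE_iff)
  have Sup_le: "unit_Sup A \<le> b \<longleftrightarrow> (\<forall>a\<in>A. a \<le> b)" if "A \<subseteq> {0..1}" "0 \<le> b" for A b
    using that cSup_le_iff[of A b] by (auto simp: unit_Sup_def bdd_above_def subset_iff)
  have le_Inf: "b \<le> unit_Inf A \<longleftrightarrow> (\<forall>a\<in>A. b \<le> a)" if "A \<subseteq> {0..1}" "b \<le> 1" for A b
    using that le_cInf_iff[of A b] by (auto simp: unit_Inf_def bdd_below_def subset_iff)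
  have Sup01: "unit_Sup A \<in> {0..1}" if A: "A \<subseteq> {0..1}" for A
  proof (cases "A = {}")
    case False
    then obtain a where a: "a \<in> A" by blast
    have "a \<le> Sup A" using A a by (intro cSup_upper bdd_above_mono[OF _ A]) auto
    then show ?thesis using A a False Sup_le[OF A, of 1] by (force simp: unit_Sup_def)
  qed (simp add: unit_Sup_def)
  have Inf01: "unit_Inf A \<in> {0..1}" if A: "A \<subseteq> {0..1}" for A
  proof (cases "A = {}")
    case False
    then obtain a where a: "a \<in> A" by blast
    have "Inf A \<le> a" using A a by (intro cInf_lower bdd_below_mono[OF _ A]) auto
    then show ?thesis using A a False le_Inf[OF A, of 0] by (force simp: unit_Inf_def)
  qed (simp add: unit_Inf_def)
  have subS: "{p s |s. s \<in> S \<and> (s, t) \<in> R} \<subseteq> {0..1}" if "p \<in> S \<rightarrow>\<^sub>E {0..1}" for p :: "_ \<Rightarrow> real" and t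
    using that by (auto simp: PiE_iff)
  have subT: "{p t |t. t \<in> T \<and> (s, t) \<in> R} \<subseteq> {0..1}" if "p \<in> T \<rightarrow>\<^sub>E {0..1}" for p :: "_ \<Rightarrow> real" and s
    using that by (auto simp: PiE_iff)
  have P: "canonical_P S T R p = (\<lambda>t\<in>T. unit_Sup {p s | s. s \<in> S \<and> (s, t) \<in> R})"
    if "p \<in> S \<rightarrow>\<^sub>E {0..1}" for p
    using that by (simp add: canonical_P_def car)
  have G: "canonical_G S T R p = (\<lambda>s\<in>S. unit_Inf {p t | t. t \<in> T \<and> (s, t) \<in> R})"
    if "p \<in> T \<rightarrow>\<^sub>E {0..1}" for p
    using that by (simp add: canonical_G_def car)
  have Pc: "canonical_P S T R p \<in> T \<rightarrow>\<^sub>E {0..1}" if "p \<in> S \<rightarrow>\<^sub>E {0..1}" for p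
    unfolding P[OF that] using Sup01[OF subS[OF that]] by (intro restrict_PiE_iff[THEN iffD2]) blast
  have Gc: "canonical_G S T R p \<in> S \<rightarrow>\<^sub>E {0..1}" if "p \<in> T \<rightarrow>\<^sub>E {0..1}" for p
    unfolding G[OF that] using Inf01[OF subT[OF that]] by (intro restrict_PiE_iff[THEN iffD2]) blast
  have "ea_le ?T (canonical_P S T R a) b \<longleftrightarrow> ea_le ?S a (canonical_G S T R b)"
    if a: "a \<in> S \<rightarrow>\<^sub>E {0..1}" and b: "b \<in> T \<rightarrow>\<^sub>E {0..1}" for a b
  proof -
    have "ea_le ?T (canonical_P S T R a) b \<longleftrightarrow>
        (\<forall>t\<in>T. unit_Sup {a s |s. s \<in> S \<and> (s, t) \<in> R} \<le> b t)"
      unfolding leT[OF Pc[OF a] b] by (simp add: P[OF a])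
    also have "\<dots> \<longleftrightarrow> (\<forall>t\<in>T. \<forall>s\<in>S. (s, t) \<in> R \<longrightarrow> a s \<le> b t)"
      using b by (intro ball_cong refl, subst Sup_le[OF subS[OF a]]) (auto simp: PiE_iff)
    also have "\<dots> \<longleftrightarrow> (\<forall>s\<in>S. a s \<le> unit_Inf {b t |t. t \<in> T \<and> (s, t) \<in> R})"
    proof -
      have "a s \<le> unit_Inf {b t |t. t \<in> T \<and> (s, t) \<in> R} \<longleftrightarrow> (\<forall>t\<in>T. (s, t) \<in> R \<longrightarrow> a s \<le> b t)"
        if "s \<in> S" for s
        using a that by (subst le_Inf[OF subT[OF b]]) (auto simp: PiE_iff)
      then show ?thesis by blast
    qed
    also have "\<dots> \<longleftrightarrow> ea_le ?S a (canonical_G S T R b)"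
      unfolding leS[OF a Gc[OF b]] by (simp add: G[OF b])
    finally show ?thesis .
  qed
  then show ?thesis
    unfolding galois_connection_def car using Pc Gc by blast
qed

end

theory Submission
  imports Defs "HOL-Analysis.Function_Topology"
begin

text \<open>Everything reduces to one extension theorem. For a q-state \<open>s\<close> on \<open>E1\<close> the map
  \<open>s \<circ> g\<close> need not be additive, but it is a \<^emph>\<open>q-semistate\<close>: monotone, compatible with \<open>q\<close>
  and \<open>d\<close>, and Jauch-Piron. Since \<open>s R t\<close> means \<open>s \<circ> g \<le> t\<close>, the equation for \<open>g\<close> says
  that \<open>s \<circ> g\<close> is the pointwise infimum of the q-states above it, and theorem
  \<open>q_semistate_extension\<close> proves this for every q-semistate \<open>p\<close> on a q-representable algebra:
  given \<open>p x < c \<le> 1\<close> there is a q-state \<open>t \<ge> p\<close> with \<open>t x < c\<close>. The equation for \<open>f\<close> is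
  the same fact on \<open>E1\<close> for the q-semistate \<open>y \<mapsto> 1 - t (f y')\<close>, because complementation turns
  \<open>s R t\<close>, which is also equivalent to \<open>s \<le> t \<circ> f\<close>, into \<open>1 - t (f y') \<le> s y\<close>. That every
  q-state is Jauch-Piron puts the q-states so constructed into \<open>T\<close> and \<open>S\<close>.

  The extension theorem rests on two ideas. First, the compositions of \<open>q\<close> and \<open>d\<close> contain, for
  every dyadic interval \<open>[k/2^n, (k+1)/2^n]\<close>, a term that every map compatible with \<open>q\<close> and
  \<open>d\<close> evaluates as the ramp climbing from 0 to 1 over this interval. Inequalities between
  values of \<open>p\<close> and \<open>t\<close> are therefore controlled by the elements where \<open>p\<close> is 1 or 0.
  By the Jauch-Piron property the former make up a filter \<open>F\<close>, which is closed under \<open>d\<close>; the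
  latter make up a set closed under \<open>q\<close>. Secondly, the q-states form a compact space, so that a q-state with prescribed closed
  behaviour on all of \<open>F\<close> exists as soon as one exists for each single element of \<open>F\<close>. If
  \<open>z \<in> F\<close> and \<open>p a = 0\<close>, then \<open>d z \<le> q a\<close> fails by monotonicity of \<open>p\<close>, and an order
  reflecting set of q-states contains some \<open>t\<close> with \<open>t (d z) > t (q a)\<close>, which forces
  \<open>t z > 1/2 > t a\<close>.\<close>

section \<open>q-states and the induced order\<close>

lemma q_stateD:
  assumes "q_state E s"
  shows "x \<in> carrier E \<Longrightarrow> 0 \<le> s x" "x \<in> carrier E \<Longrightarrow> s x \<le> 1"
    "s (bottom E) = 0" "s (unit_elt E) = 1"
    "x \<in> carrier E \<Longrightarrow> s (q_op E x) = luk_oplus (s x) (s x)"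
    "x \<in> carrier E \<Longrightarrow> s (d_op E x) = luk_odot (s x) (s x)"
  using assms by (auto simp: q_state_def PiE_iff)

lemma q_state_padd:
  assumes "q_state E s" "x \<in> carrier E" "y \<in> carrier E" "padd E x y = Some u"
  shows "s u = s x + s y"
  using assms by (auto simp: q_state_def)

lemma q_state_mono:
  assumes "q_state E s" "x \<in> carrier E" "ea_le E x y"
  shows "s x \<le> s y"
proof -
  from assms(3) obtain z where z: "z \<in> carrier E" "padd E x z = Some y"
    by (auto simp: ea_le_def)
  then have "s y = s x + s z" using q_state_padd[OF assms(1,2)] by simp
  then show ?thesis using q_stateD(1)[OF assms(1) z(1)] by simp
qed

text \<open>On a q-representable algebra the order is pointwise comparison of q-states, so reflexivity,
  transitivity and antitonicity of the complement come for free.\<close>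

lemma ea_le_iff_q_states:
  assumes "q_representable E" "x \<in> carrier E" "y \<in> carrier E"
  shows "ea_le E x y \<longleftrightarrow> (\<forall>s. q_state E s \<longrightarrow> s x \<le> s y)"
  using assms q_state_mono unfolding q_representable_def order_reflecting_def by metis

context effect_algebra
begin

lemma ea_compl_ea_compl:
  assumes "x \<in> carrier E"
  shows "ea_compl E (ea_compl E x) = x"
  using ea_compl_eq[OF ea_compl_props(1)[OF assms] assms] E1[OF assms ea_compl_props[OF assms]] .

lemma unit_not_le_bottom: "\<not> ea_le E (unit_elt E) (bottom E)"
proof
  assume "ea_le E (unit_elt E) (bottom E)"
  then obtain z where z: "z \<in> carrier E" "padd E (unit_elt E) z = Some (bottom E)"
    by (auto simp: ea_le_def)
  have z0: "z = bottom E" using E1[OF unit_closed z] z(1) by (intro E4) auto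
  let ?u = "ea_compl E (unit_elt E)"
  have u: "?u \<in> carrier E" "padd E (unit_elt E) ?u = Some (unit_elt E)"
    using ea_compl_props[OF unit_closed] .
  have "?u = bottom E" using E1[OF unit_closed u] u(1) by (intro E4) auto
  with u z z0 bottom_neq_unit show False by auto
qed

end

context q_effect_algebra
begin

lemma q_state_compl:
  assumes "q_state E s" "x \<in> carrier E"
  shows "s (ea_compl E x) = 1 - s x"
  using q_state_padd[OF assms ea_compl_props[OF assms(2)]] q_stateD(4)[OF assms(1)] by simp

lemma ea_compl_antimono:
  assumes "q_representable E" "x \<in> carrier E" "y \<in> carrier E" "ea_le E x y"
  shows "ea_le E (ea_compl E y) (ea_compl E x)"
  using assms by (simp add: ea_le_iff_q_states ea_compl_props q_state_compl)

lemma compl_d_op: "x \<in> carrier E \<Longrightarrow> ea_compl E (d_op E x) = q_op E (ea_compl E x)"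
  using Q1[of "ea_compl E x"] by (simp add: ea_compl_props ea_compl_ea_compl q_closed)

lemma ex_q_state:
  assumes "q_representable E"
  shows "\<exists>s. q_state E s"
  using unit_not_le_bottom
  unfolding ea_le_iff_q_states[OF assms unit_closed bottom_closed] by auto

end

text \<open>Off the carrier a q-state is fixed to \<open>undefined\<close>, so q-states form a closed subset of a
  product of compact sets over the whole type.\<close>

lemma compact_q_states: "compact {s. q_state E s}"
proof -
  define K where "K = (\<Pi>\<^sub>E x\<in>UNIV. if x \<in> carrier E then {0..1::real} else {undefined})"
  define C where "C = {s. s (bottom E) = (0::real)} \<inter> {s. s (unit_elt E) = 1}
     \<inter> (\<Inter>x\<in>carrier E. \<Inter>y\<in>carrier E. \<Inter>u\<in>{u. padd E x y = Some u}. {s. s u = s x + s y})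
     \<inter> (\<Inter>x\<in>carrier E. {s. s (q_op E x) = luk_oplus (s x) (s x)})
     \<inter> (\<Inter>x\<in>carrier E. {s. s (d_op E x) = luk_odot (s x) (s x)})"
  have "compactin (product_topology (\<lambda>_. euclidean) UNIV) K"
    unfolding K_def by (simp add: compactin_PiE)
  then have "compact K"
    by (simp add: euclidean_product_topology)
  moreover have "closed C"
    unfolding C_def luk_oplus_def luk_odot_def
    by (intro closed_Int closed_INT ballI closed_Collect_eq continuous_intros
        continuous_on_product_coordinates)
  moreover have "{s. q_state E s} = K \<inter> C"
    by (auto simp: q_state_def K_def C_def PiE_iff extensional_def split: if_splits)
  ultimately show ?thesis by (simp add: compact_Int_closed)
qed

section \<open>Dyadic ramps\<close>

text \<open>The value of \<open>ramp E n k\<close> under a map into \<open>[0,1]\<close> compatible with \<open>q\<close> and \<open>d\<close> rises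
  linearly from 0 to 1 on \<open>[k/2^n, (k+1)/2^n]\<close> and is constant elsewhere. The binary digits of
  \<open>k\<close>, the highest first, say which of the two halves of the current interval to enlarge:
  \<open>q\<close> enlarges the lower half and \<open>d\<close> the upper one.\<close>

fun ramp :: "('a, 'm) q_effect_algebra_scheme \<Rightarrow> nat \<Rightarrow> nat \<Rightarrow> 'a \<Rightarrow> 'a" where
  "ramp E 0 k x = x"
| "ramp E (Suc n) k x =
     (if k < 2 ^ n then ramp E n k (q_op E x) else ramp E n (k - 2 ^ n) (d_op E x))"

lemma (in q_effect_algebra) ramp_closed: "x \<in> carrier E \<Longrightarrow> ramp E n k x \<in> carrier E"
  by (induction n arbitrary: k x) (auto simp: q_closed d_closed)

lemma (in q_effect_algebra) ramp_value:
  fixes p :: "'a \<Rightarrow> real"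
  assumes p: "\<And>x. x \<in> carrier E \<Longrightarrow> 0 \<le> p x \<and> p x \<le> 1"
    and q: "\<And>x. x \<in> carrier E \<Longrightarrow> p (q_op E x) = luk_oplus (p x) (p x)"
    and d: "\<And>x. x \<in> carrier E \<Longrightarrow> p (d_op E x) = luk_odot (p x) (p x)"
  shows "x \<in> carrier E \<Longrightarrow> k < 2 ^ n \<Longrightarrow>
    p (ramp E n k x) = max 0 (min 1 (2 ^ n * p x - real k))"
proof (induction n arbitrary: k x)
  case 0
  then show ?case using p by auto
next
  case (Suc n)
  show ?case
  proof (cases "k < 2 ^ n")
    case True
    then have k: "real k + 1 \<le> 2 ^ n"
      by (metis Suc_leI of_nat_Suc of_nat_le_iff of_nat_numeral of_nat_power add.commute)
    have "p (ramp E (Suc n) k x) = max 0 (min 1 (2 ^ n * p (q_op E x) - real k))"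
      using True Suc q_closed by simp
    also have "2 ^ n * p (q_op E x) = min (2 ^ n) (2 ^ Suc n * p x)"
      unfolding q[OF Suc.prems(1)] luk_oplus_def by (auto simp: min_def algebra_simps)
    also have "max 0 (min 1 (min (2 ^ n) (2 ^ Suc n * p x) - real k))
        = max 0 (min 1 (2 ^ Suc n * p x - real k))"
      using k by (smt (verit))
    finally show ?thesis .
  next
    case False
    then have k: "2 ^ n \<le> k" "k - 2 ^ n < 2 ^ n" using Suc.prems(2) by auto
    then have k': "real (k - 2 ^ n) = real k - 2 ^ n" by (simp add: of_nat_diff)
    then have nonneg: "0 \<le> real k - 2 ^ n" by linarith
    have "p (ramp E (Suc n) k x) = max 0 (min 1 (2 ^ n * p (d_op E x) - real (k - 2 ^ n)))"
      using False k Suc d_closed by simp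
    also have "2 ^ n * p (d_op E x) = max 0 (2 ^ Suc n * p x - 2 ^ n)"
      unfolding d[OF Suc.prems(1)] luk_odot_def by (auto simp: max_def algebra_simps)
    also have "max 0 (min 1 (max 0 (2 ^ Suc n * p x - 2 ^ n) - real (k - 2 ^ n)))
        = max 0 (min 1 (2 ^ Suc n * p x - real k))"
      using nonneg unfolding k' by (smt (verit))
    finally show ?thesis .
  qed
qed

lemma dyadic_interval_between:
  fixes u v :: real
  assumes "0 \<le> u" "u < v" "v \<le> 1"
  obtains n k :: nat where "k < 2 ^ n" "2 ^ n * u \<le> real k" "real k + 1 \<le> 2 ^ n * v"
proof -
  obtain n where "2 / (v - u) < 2 ^ n"
    using real_arch_pow[of 2 "2 / (v - u)"] by auto
  then have n: "2 < 2 ^ n * v - 2 ^ n * u"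
    using assms by (simp add: divide_less_eq algebra_simps)
  define k where "k = nat \<lceil>2 ^ n * u\<rceil>"
  have "real k = of_int \<lceil>2 ^ n * u\<rceil>" using assms by (simp add: k_def)
  then have k: "2 ^ n * u \<le> real k" "real k < 2 ^ n * u + 1" by linarith+
  have "2 ^ n * v \<le> 2 ^ n" using assms by simp
  then have "real k < 2 ^ n" using k n by linarith
  then have "k < 2 ^ n" by (metis of_nat_less_iff of_nat_numeral of_nat_power)
  moreover have "real k + 1 \<le> 2 ^ n * v" using k n by linarith
  ultimately show ?thesis using that k(1) by blast
qed

section \<open>Extension of q-semistates to q-states\<close>

definition q_semistate :: "('a, 'm) q_effect_algebra_scheme \<Rightarrow> ('a \<Rightarrow> real) \<Rightarrow> bool" where
  "q_semistate E p \<longleftrightarrow>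
     (\<forall>x\<in>carrier E. 0 \<le> p x \<and> p x \<le> 1) \<and> p (unit_elt E) = 1 \<and>
     (\<forall>x\<in>carrier E. \<forall>y\<in>carrier E. ea_le E x y \<longrightarrow> p x \<le> p y) \<and>
     (\<forall>x\<in>carrier E. p (q_op E x) = luk_oplus (p x) (p x)) \<and>
     (\<forall>x\<in>carrier E. p (d_op E x) = luk_odot (p x) (p x)) \<and>
     jauch_piron E p"

context q_effect_algebra
begin

text \<open>Finitely many elements of the filter have a lower bound in it, and one q-state that is
  large at the bound is large at all of them; compactness handles the whole filter.\<close>

lemma q_state_separating_filter:
  assumes rep: "q_representable E" and p: "q_semistate E p"
    and a: "a \<in> carrier E" "p a = 0"
  shows "\<exists>t. q_state E t \<and> t a \<le> 1/2 \<and> (\<forall>y\<in>carrier E. p y = 1 \<longrightarrow> 1/2 \<le> t y)"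
proof -
  define F where "F = {y \<in> carrier E. p y = 1}"
  have lower: "\<exists>z\<in>F. \<forall>y\<in>I. ea_le E z y" if "finite I" "I \<subseteq> F" for I
    using that
  proof (induction I)
    case empty
    then show ?case using p unit_closed by (auto simp: F_def q_semistate_def)
  next
    case (insert y I)
    then obtain z where z: "z \<in> F" "\<forall>y\<in>I. ea_le E z y" by auto
    moreover have "y \<in> F" using insert by auto
    ultimately obtain w where w: "w \<in> F" "ea_le E w z" "ea_le E w y"
      using p by (fastforce simp: F_def q_semistate_def jauch_piron_def)
    have "ea_le E w v" if "v \<in> I" for v
    proof -
      have "v \<in> F" using that insert by auto
      then show ?thesis
        using z w that by (force simp: F_def ea_le_iff_q_states[OF rep] intro: order_trans)
    qed
    with w show ?case by auto
  qed
  have "{t. q_state E t} \<inter> (\<Inter>y\<in>F. {t. 1/2 \<le> t y \<and> t a \<le> 1/2}) \<noteq> {}"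
  proof (rule compact_imp_fip_image[OF compact_q_states])
    show "closed {t :: 'a \<Rightarrow> real. 1/2 \<le> t y \<and> t a \<le> 1/2}" for y
      by (intro closed_Collect_conj closed_Collect_le continuous_intros
          continuous_on_product_coordinates)
  next
    fix I assume I: "finite I" "I \<subseteq> F"
    then obtain z where z: "z \<in> carrier E" "p z = 1" "\<forall>y\<in>I. ea_le E z y"
      using lower[OF I] by (auto simp: F_def)
    have "p (d_op E z) = 1" "p (q_op E a) = 0"
      using p a z by (auto simp: q_semistate_def luk_oplus_def luk_odot_def)
    moreover have "p (d_op E z) \<le> p (q_op E a)" if "ea_le E (d_op E z) (q_op E a)"
      using p that d_closed[OF z(1)] q_closed[OF a(1)] unfolding q_semistate_def by blast
    ultimately have "\<not> ea_le E (d_op E z) (q_op E a)" by auto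
    then obtain t where t: "q_state E t" "t (q_op E a) < t (d_op E z)"
      using a z by (auto simp: ea_le_iff_q_states[OF rep] q_closed d_closed not_le)
    have "luk_oplus (t a) (t a) < luk_odot (t z) (t z)"
      using t q_stateD(5,6)[OF t(1)] a z by simp
    then have half: "1/2 \<le> t z" "t a \<le> 1/2"
      using q_stateD(1,2)[OF t(1) a(1)] q_stateD(1,2)[OF t(1) z(1)]
      by (auto simp: luk_oplus_def luk_odot_def max_def min_def split: if_splits)
    have "1/2 \<le> t y" if "y \<in> I" for y
      using q_state_mono[OF t(1) z(1), of y] z(3) that half by auto
    with t half show "{t. q_state E t} \<inter> (\<Inter>y\<in>I. {t. 1/2 \<le> t y \<and> t a \<le> 1/2}) \<noteq> {}"
      by auto
  qed
  moreover have "unit_elt E \<in> F"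
    using p unit_closed by (auto simp: F_def q_semistate_def)
  ultimately show ?thesis by (auto simp: F_def)
qed

text \<open>A ramp over a dyadic interval between \<open>p x\<close> and \<open>c\<close> vanishes at \<open>x\<close> under \<open>p\<close>, which makes it an
  element to separate from the filter. That the resulting \<open>t\<close> dominates \<open>p\<close> is again read off from
  ramps: if \<open>t y < p y\<close>, then a ramp between these two values lies in the filter, yet \<open>t\<close>
  vanishes on it. The bound \<open>c \<le> 1\<close> matters: if \<open>p\<close> is constantly 1, no q-state lies above it.\<close>

theorem q_semistate_extension:
  assumes rep: "q_representable E" and p: "q_semistate E p"
    and x: "x \<in> carrier E" and c: "p x < c" "c \<le> 1"
  shows "\<exists>t. q_state E t \<and> (\<forall>y\<in>carrier E. p y \<le> t y) \<and> t x < c"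
proof -
  have p01: "0 \<le> p y" "p y \<le> 1" if "y \<in> carrier E" for y
    using p that by (auto simp: q_semistate_def)
  have ramp_p: "p (ramp E n k y) = max 0 (min 1 (2 ^ n * p y - real k))"
    if "y \<in> carrier E" "k < 2 ^ n" for y n k
    using p that by (intro ramp_value) (auto simp: q_semistate_def)
  obtain n k where nk: "k < 2 ^ n" "2 ^ n * p x \<le> real k" "real k + 1 \<le> 2 ^ n * c"
    using dyadic_interval_between p01(1)[OF x] c by metis
  have "p (ramp E n k x) = 0" using ramp_p[OF x nk(1)] nk(2) by simp
  then obtain t where t: "q_state E t" "t (ramp E n k x) \<le> 1/2"
      "\<And>y. y \<in> carrier E \<Longrightarrow> p y = 1 \<Longrightarrow> 1/2 \<le> t y"
    using q_state_separating_filter[OF rep p ramp_closed[OF x]] by metis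
  have ramp_t: "t (ramp E n k y) = max 0 (min 1 (2 ^ n * t y - real k))"
    if "y \<in> carrier E" "k < 2 ^ n" for y n k
    using q_stateD[OF t(1)] that by (intro ramp_value) auto
  have "2 ^ n * t x < real k + 1"
    using t(2) unfolding ramp_t[OF x nk(1)] by (simp add: min_def max_def split: if_splits)
  then have "2 ^ n * t x < 2 ^ n * c" using nk(3) by linarith
  then have "t x < c" by simp
  moreover have "p y \<le> t y" if y: "y \<in> carrier E" for y
  proof (rule ccontr)
    assume "\<not> p y \<le> t y"
    then have "t y < p y" by simp
    then obtain m j where mj: "j < 2 ^ m" "2 ^ m * t y \<le> real j" "real j + 1 \<le> 2 ^ m * p y"
      using dyadic_interval_between q_stateD(1)[OF t(1) y] p01(2)[OF y] by metis
    have "p (ramp E m j y) = 1" using ramp_p[OF y mj(1)] mj(3) by simp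
    then have "1/2 \<le> t (ramp E m j y)" by (intro t(3) ramp_closed y)
    then show False using ramp_t[OF y mj(1)] mj(2) by simp
  qed
  ultimately show ?thesis using t(1) by blast
qed

end

section \<open>The semistates of a Galois q-connection\<close>

locale galois_q_connected =
  A: q_effect_algebra E1 + B: q_effect_algebra E2
  for E1 :: "'a q_effect_algebra" and E2 :: "'b q_effect_algebra" +
  fixes f :: "'a \<Rightarrow> 'b" and g :: "'b \<Rightarrow> 'a"
  assumes rep1: "q_representable E1" and rep2: "q_representable E2"
    and conn: "galois_q_connection E1 E2 f g"
begin

lemma f_closed: "x \<in> carrier E1 \<Longrightarrow> f x \<in> carrier E2"
  and g_closed: "y \<in> carrier E2 \<Longrightarrow> g y \<in> carrier E1"
  and galois: "\<lbrakk>x \<in> carrier E1; y \<in> carrier E2\<rbrakk> \<Longrightarrow> ea_le E2 (f x) y \<longleftrightarrow> ea_le E1 x (g y)"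
  and f_q: "x \<in> carrier E1 \<Longrightarrow> f (q_op E1 x) = q_op E2 (f x)"
  and f_d: "x \<in> carrier E1 \<Longrightarrow> f (d_op E1 x) = d_op E2 (f x)"
  and g_q: "y \<in> carrier E2 \<Longrightarrow> g (q_op E2 y) = q_op E1 (g y)"
  and g_d: "y \<in> carrier E2 \<Longrightarrow> g (d_op E2 y) = d_op E1 (g y)"
  using conn by (auto simp: galois_q_connection_def galois_connection_def)

lemma le_g_f: "x \<in> carrier E1 \<Longrightarrow> ea_le E1 x (g (f x))"
  by (simp add: galois[symmetric] f_closed ea_le_iff_q_states[OF rep2])

lemma f_g_le: "y \<in> carrier E2 \<Longrightarrow> ea_le E2 (f (g y)) y"
  by (simp add: galois g_closed ea_le_iff_q_states[OF rep1])

lemma f_mono: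
  assumes "x \<in> carrier E1" "y \<in> carrier E1" "ea_le E1 x y"
  shows "ea_le E2 (f x) (f y)"
  using assms le_g_f[OF assms(2)] unfolding galois[OF assms(1) f_closed[OF assms(2)]]
  by (force simp: ea_le_iff_q_states[OF rep1] f_closed g_closed intro: order_trans)

lemma g_mono:
  assumes "x \<in> carrier E2" "y \<in> carrier E2" "ea_le E2 x y"
  shows "ea_le E1 (g x) (g y)"
  using assms f_g_le[OF assms(1)] unfolding galois[OF g_closed[OF assms(1)] assms(2), symmetric]
  by (force simp: ea_le_iff_q_states[OF rep2] f_closed g_closed intro: order_trans)

lemma g_unit:
  assumes "q_state E1 s"
  shows "s (g (unit_elt E2)) = 1"
proof -
  have "ea_le E2 (f (unit_elt E1)) (unit_elt E2)"
    by (simp add: ea_le_iff_q_states[OF rep2] f_closed A.unit_closed B.unit_closed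
        q_stateD(4) q_stateD(2)[of E2])
  then have "s (unit_elt E1) \<le> s (g (unit_elt E2))"
    by (intro q_state_mono[OF assms]) (simp_all add: galois A.unit_closed B.unit_closed)
  then show ?thesis
    using q_stateD(2,4)[OF assms] g_closed[OF B.unit_closed] by force
qed

lemma f_bottom:
  assumes "q_state E2 t"
  shows "t (f (bottom E1)) = 0"
proof -
  have "ea_le E1 (bottom E1) (g (bottom E2))"
    by (simp add: ea_le_iff_q_states[OF rep1] g_closed A.bottom_closed B.bottom_closed
        q_stateD(3) q_stateD(1)[of E1])
  then have "t (f (bottom E1)) \<le> t (bottom E2)"
    by (intro q_state_mono[OF assms]) (simp_all add: galois f_closed A.bottom_closed B.bottom_closed)
  then show ?thesis
    using q_stateD(1,3)[OF assms] f_closed[OF A.bottom_closed] by force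
qed

text \<open>A common lower bound \<open>w\<close> of \<open>g x\<close> and \<open>g y\<close> is carried by \<open>f\<close> to a common lower
  bound of \<open>x\<close> and \<open>y\<close>.\<close>

lemma q_semistate_g:
  assumes s: "q_state E1 s" and jp: "jauch_piron E1 s"
  shows "q_semistate E2 (\<lambda>y. s (g y))"
proof -
  have "jauch_piron E2 (\<lambda>y. s (g y))"
    unfolding jauch_piron_def
  proof (intro ballI impI)
    fix x y assume x: "x \<in> carrier E2" and y: "y \<in> carrier E2" and "s (g x) = 1 \<and> s (g y) = 1"
    then obtain w where w: "w \<in> carrier E1" "ea_le E1 w (g x)" "ea_le E1 w (g y)" "s w = 1"
      using jp g_closed[OF x] g_closed[OF y] unfolding jauch_piron_def by metis
    have "s w \<le> s (g (f w))" by (intro q_state_mono[OF s] w le_g_f)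
    then have "s (g (f w)) = 1"
      using w q_stateD(2)[OF s, of "g (f w)"] by (auto simp: g_closed f_closed)
    then show "\<exists>z\<in>carrier E2. ea_le E2 z x \<and> ea_le E2 z y \<and> s (g z) = 1"
      using w x y by (intro bexI[of _ "f w"]) (simp_all add: galois f_closed)
  qed
  then show ?thesis
    unfolding q_semistate_def
    using q_stateD(1,2,5,6)[OF s] g_unit[OF s]
    by (auto simp: g_closed g_q g_d intro: q_state_mono[OF s] g_mono)
qed

text \<open>Since \<open>1 - t (f y') = t ((f y')')\<close> and the map \<open>y \<mapsto> (f y')'\<close> is the upper adjoint of
  \<open>x \<mapsto> (g x')'\<close>, the reason is the same as in \<open>q_semistate_g\<close>: a lower bound \<open>z\<close> in \<open>E2\<close> is
  carried to \<open>(g z')'\<close>.\<close>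

lemma q_semistate_f:
  assumes t: "q_state E2 t" and jp: "jauch_piron E2 t"
  shows "q_semistate E1 (\<lambda>y. 1 - t (f (ea_compl E1 y)))"
proof -
  let ?c1 = "ea_compl E1" and ?c2 = "ea_compl E2"
  note cl = A.ea_compl_props(1) B.ea_compl_props(1) f_closed g_closed
  have "jauch_piron E1 (\<lambda>y. 1 - t (f (?c1 y)))"
    unfolding jauch_piron_def
  proof (intro ballI impI)
    fix x y assume x: "x \<in> carrier E1" and y: "y \<in> carrier E1"
      and "1 - t (f (?c1 x)) = 1 \<and> 1 - t (f (?c1 y)) = 1"
    then have "t (?c2 (f (?c1 x))) = 1" "t (?c2 (f (?c1 y))) = 1"
      by (simp_all add: B.q_state_compl[OF t] cl)
    then obtain z where z: "z \<in> carrier E2" "ea_le E2 z (?c2 (f (?c1 x)))"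
        "ea_le E2 z (?c2 (f (?c1 y)))" "t z = 1"
      using jp x y unfolding jauch_piron_def by (meson cl)
    have below: "ea_le E1 (?c1 (g (?c2 z))) v" if v: "v \<in> carrier E1" "ea_le E2 z (?c2 (f (?c1 v)))" for v
    proof -
      have "ea_le E2 (f (?c1 v)) (?c2 z)"
        using B.ea_compl_antimono[OF rep2 z(1) _ v(2)] v(1) by (simp add: cl B.ea_compl_ea_compl)
      then have "ea_le E1 (?c1 v) (g (?c2 z))" using v z by (simp add: galois cl)
      then show ?thesis
        using A.ea_compl_antimono[OF rep1, of "?c1 v" "g (?c2 z)"] v z by (simp add: cl A.ea_compl_ea_compl)
    qed
    have "t (f (g (?c2 z))) \<le> t (?c2 z)"
      using z by (intro q_state_mono[OF t] f_g_le) (simp_all add: cl)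
    then have "t (f (g (?c2 z))) = 0"
      using z q_stateD(1)[OF t, of "f (g (?c2 z))"] by (simp add: B.q_state_compl[OF t] cl)
    then show "\<exists>w\<in>carrier E1. ea_le E1 w x \<and> ea_le E1 w y \<and> 1 - t (f (?c1 w)) = 1"
      using x y z by (intro bexI[of _ "?c1 (g (?c2 z))"]) (simp_all add: below cl A.ea_compl_ea_compl)
  qed
  moreover have "?c1 (unit_elt E1) = bottom E1"
    using A.E1[OF A.unit_closed A.ea_compl_props[OF A.unit_closed]] A.ea_compl_props(1)[OF A.unit_closed]
    by (intro A.E4) auto
  moreover have "t (f (?c1 y)) \<le> t (f (?c1 x))"
    if "x \<in> carrier E1" "y \<in> carrier E1" "ea_le E1 x y" for x y
    using that by (intro q_state_mono[OF t] f_mono A.ea_compl_antimono[OF rep1]) (simp_all add: cl)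
  ultimately show ?thesis
    unfolding q_semistate_def
    using q_stateD(1,2)[OF t] f_bottom[OF t]
    by (auto simp: cl A.Q1[symmetric] A.compl_d_op f_d f_q q_stateD(5,6)[OF t]
        luk_oplus_def luk_odot_def min_def max_def)
qed

text \<open>The two descriptions \<open>s \<circ> g \<le> t\<close> and \<open>s \<le> t \<circ> f\<close> of the relation agree, as for any
  Galois connection.\<close>

lemma s_g_le_t_iff_s_le_t_f:
  assumes s: "q_state E1 s" and t: "q_state E2 t"
  shows "(\<forall>y\<in>carrier E2. s (g y) \<le> t y) \<longleftrightarrow> (\<forall>x\<in>carrier E1. s x \<le> t (f x))"
proof
  assume "\<forall>y\<in>carrier E2. s (g y) \<le> t y"
  then show "\<forall>x\<in>carrier E1. s x \<le> t (f x)"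
    by (meson f_closed le_g_f order_trans q_state_mono[OF s])
next
  assume "\<forall>x\<in>carrier E1. s x \<le> t (f x)"
  then show "\<forall>y\<in>carrier E2. s (g y) \<le> t y"
    by (meson f_closed f_g_le g_closed order_trans q_state_mono[OF t])
qed

lemma ex_q_state_near_g:
  assumes "q_state E1 s" "jauch_piron E1 s" "y \<in> carrier E2" "s (g y) < c" "c \<le> 1"
  shows "\<exists>t. q_state E2 t \<and> (\<forall>x\<in>carrier E2. s (g x) \<le> t x) \<and> t y < c"
  using B.q_semistate_extension[OF rep2 q_semistate_g] assms by blast

lemma ex_q_state_near_f:
  assumes t: "q_state E2 t" "jauch_piron E2 t" and x: "x \<in> carrier E1" and c: "0 \<le> c" "c < t (f x)"
  shows "\<exists>s. q_state E1 s \<and> (\<forall>y\<in>carrier E2. s (g y) \<le> t y) \<and> c < s x"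
proof -
  obtain s where s: "q_state E1 s"
      "\<And>y. y \<in> carrier E1 \<Longrightarrow> 1 - t (f (ea_compl E1 y)) \<le> s y" "s (ea_compl E1 x) < 1 - c"
    using A.q_semistate_extension[OF rep1 q_semistate_f[OF t], of "ea_compl E1 x" "1 - c"] x c
    by (auto simp: A.ea_compl_props A.ea_compl_ea_compl)
  have "s y \<le> t (f y)" if "y \<in> carrier E1" for y
    using s(2)[of "ea_compl E1 y"] that
    by (simp add: A.ea_compl_props A.ea_compl_ea_compl A.q_state_compl[OF s(1)])
  moreover have "c < s x"
    using s(3) x by (simp add: A.q_state_compl[OF s(1)])
  ultimately show ?thesis
    using s(1) s_g_le_t_iff_s_le_t_f[OF s(1) t(1)] by auto
qed

end

section \<open>The representation theorem\<close>

lemma unit_Inf_eqI: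
  assumes "\<And>a. a \<in> A \<Longrightarrow> m \<le> a \<and> a \<le> 1" "m \<le> 1"
    and "\<And>c. m < c \<Longrightarrow> c \<le> 1 \<Longrightarrow> \<exists>a\<in>A. a < c"
  shows "unit_Inf A = m"
proof (cases "A = {}")
  case True
  with assms(2) assms(3)[of 1] show ?thesis by (force simp: unit_Inf_def)
next
  case False
  then have "Inf A = m"
  proof (intro cInf_eq_non_empty)
    fix b assume b: "\<And>a. a \<in> A \<Longrightarrow> b \<le> a"
    from \<open>A \<noteq> {}\<close> obtain a where "a \<in> A" by blast
    then have "b \<le> 1" using assms(1) b by (meson order_trans)
    then show "b \<le> m" using assms(3)[of b] b by (meson not_le)
  qed (use assms(1) in auto)
  then show ?thesis using False by (simp add: unit_Inf_def)
qed

lemma unit_Sup_eqI: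
  assumes "\<And>a. a \<in> A \<Longrightarrow> 0 \<le> a \<and> a \<le> m" "0 \<le> m"
    and "\<And>c. 0 \<le> c \<Longrightarrow> c < m \<Longrightarrow> \<exists>a\<in>A. c < a"
  shows "unit_Sup A = m"
proof (cases "A = {}")
  case True
  with assms(2) assms(3)[of 0] show ?thesis by (force simp: unit_Sup_def)
next
  case False
  then have "Sup A = m"
  proof (intro cSup_eq_non_empty)
    fix b assume b: "\<And>a. a \<in> A \<Longrightarrow> a \<le> b"
    from \<open>A \<noteq> {}\<close> obtain a where "a \<in> A" by blast
    then have "0 \<le> b" using assms(1) b by (meson order_trans)
    then show "m \<le> b" using assms(3)[of b] b by (meson not_le)
  qed (use assms(1) in auto)
  then show ?thesis using False by (simp add: unit_Sup_def)
qed

theorem theorem4: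
  fixes E1 :: "'a q_effect_algebra" and E2 :: "'b q_effect_algebra"
    and f :: "'a \<Rightarrow> 'b" and g :: "'b \<Rightarrow> 'a"
    and S :: "('a \<Rightarrow> real) set" and T :: "('b \<Rightarrow> real) set"
    and R :: "(('a \<Rightarrow> real) \<times> ('b \<Rightarrow> real)) set"
  assumes "q_effect_algebra E1" and "q_representable E1" and "q_jauch_piron E1"
    and "q_effect_algebra E2" and "q_representable E2" and "q_jauch_piron E2"
    and "galois_q_connection E1 E2 f g"
    and "T = {t. q_state E2 t \<and> jauch_piron E2 t}"
    and "S = {s. q_state E1 s \<and> jauch_piron E1 s}"
    and "R = {(s, t). s \<in> S \<and> t \<in> T \<and> (\<forall>x\<in>carrier E2. s (g x) \<le> t x)}"
  shows "frame S T R
    \<and> compose (carrier E1) (eval_map E2 T) f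
        = compose (carrier E1) (canonical_P S T R) (eval_map E1 S)
    \<and> compose (carrier E2) (eval_map E1 S) g
        = compose (carrier E2) (canonical_G S T R) (eval_map E2 T)"
proof -
  interpret A: q_effect_algebra E1 by fact
  interpret B: q_effect_algebra E2 by fact
  interpret galois_q_connected E1 E2 f g
    by (intro galois_q_connected.intro galois_q_connected_axioms.intro assms)
  have S: "s \<in> S \<longleftrightarrow> q_state E1 s" and T: "t \<in> T \<longleftrightarrow> q_state E2 t" for s t
    using assms(3,6) by (auto simp: assms(8,9) q_jauch_piron_def)
  have R: "(s, t) \<in> R \<longleftrightarrow> q_state E1 s \<and> q_state E2 t \<and> (\<forall>x\<in>carrier E2. s (g x) \<le> t x)" for s t
    by (simp add: assms(10) S T)
  have jp1: "jauch_piron E1 s" if "q_state E1 s" for s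
    using assms(3) that by (simp add: q_jauch_piron_def)
  have jp2: "jauch_piron E2 t" if "q_state E2 t" for t
    using assms(6) that by (simp add: q_jauch_piron_def)
  have eval: "eval_map E1 S x \<in> carrier (power_qea standard_qea S)" if "x \<in> carrier E1" for x
    using that by (auto simp: eval_map_def power_qea_def standard_qea_def S q_stateD)
  have eval': "eval_map E2 T x \<in> carrier (power_qea standard_qea T)" if "x \<in> carrier E2" for x
    using that by (auto simp: eval_map_def power_qea_def standard_qea_def T q_stateD)
  have "frame S T R"
    using A.ex_q_state[OF rep1] B.ex_q_state[OF rep2] by (auto simp: frame_def S T R)
  moreover have "eval_map E2 T (f x) = canonical_P S T R (eval_map E1 S x)" if x: "x \<in> carrier E1" for x
  proof -
    have "unit_Sup {eval_map E1 S x s |s. s \<in> S \<and> (s, t) \<in> R} = t (f x)" if t: "q_state E2 t" for t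
    proof (rule unit_Sup_eqI)
      fix a assume "a \<in> {eval_map E1 S x s |s. s \<in> S \<and> (s, t) \<in> R}"
      then obtain s where "a = s x" "q_state E1 s" "(s, t) \<in> R"
        using x by (auto simp: eval_map_def S)
      then show "0 \<le> a \<and> a \<le> t (f x)"
        using x s_g_le_t_iff_s_le_t_f[of s t] by (simp add: R q_stateD)
    next
      fix c assume "0 \<le> c" "c < t (f x)"
      from ex_q_state_near_f[OF t jp2[OF t] x this]
      show "\<exists>a\<in>{eval_map E1 S x s |s. s \<in> S \<and> (s, t) \<in> R}. c < a"
        using x t by (auto simp: eval_map_def S R)
    qed (use x t in \<open>simp add: q_stateD f_closed\<close>)
    then show ?thesis
      using eval[OF x] x by (auto simp: canonical_P_def eval_map_def[of E2] f_closed T)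
  qed
  moreover have "eval_map E1 S (g y) = canonical_G S T R (eval_map E2 T y)" if y: "y \<in> carrier E2" for y
  proof -
    have "unit_Inf {eval_map E2 T y t |t. t \<in> T \<and> (s, t) \<in> R} = s (g y)" if s: "q_state E1 s" for s
    proof (rule unit_Inf_eqI)
      fix a assume "a \<in> {eval_map E2 T y t |t. t \<in> T \<and> (s, t) \<in> R}"
      then show "s (g y) \<le> a \<and> a \<le> 1"
        using y by (auto simp: eval_map_def T R q_stateD)
    next
      fix c assume "s (g y) < c" "c \<le> 1"
      from ex_q_state_near_g[OF s jp1[OF s] y this]
      show "\<exists>a\<in>{eval_map E2 T y t |t. t \<in> T \<and> (s, t) \<in> R}. a < c"
        using y s by (auto simp: eval_map_def T R)
    qed (use y s in \<open>simp add: q_stateD g_closed\<close>)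
    then show ?thesis
      using eval'[OF y] y by (auto simp: canonical_G_def eval_map_def[of E1] g_closed S)
  qed
  ultimately show ?thesis
    by (auto simp: compose_def fun_eq_iff)
qed

end
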